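(* Let $N_\alpha$ and $N_\beta$ be independent homogeneous Poisson processes with rates $\lambda_\alpha>0$ and $\lambda_\beta>0$ respectively. Let $X_1,X_2,\dots$ be i.i.d. Poisson random variables of parameter $\lambda_\alpha$, independent of $N_\beta$. Then for every $t>0$, $$N_\alpha(N_\beta(t))\overset{d}{=}\sum_{j=1}^{N_\beta(t)}X_j .$$
   Context: $\overset{d}{=}$ denotes equality in distribution of the two random variables for each fixed $t>0$. Poisson processes start at $0$ at time $0$; an empty sum equals $0$. *)

theory Defs
  imports "HOL-Probability.Probability"
begin

text \<open>
  A homogeneous Poisson process with time set \<open>{0..}\<close>; values at negative times are irrelevant.
  The path properties are only required almost surely. The truncated subtraction on \<^typ>\<open>nat\<close>
  is the true increment whenever the path is nondecreasing, hence almost surely.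
  \<^const>\<open>poisson_pmf\<close> is only specified for positive parameters, hence \<open>s < t\<close>.
\<close>

locale poisson_process = prob_space M for M :: "'a measure" +
  fixes rate :: real and N :: "real \<Rightarrow> 'a \<Rightarrow> nat"
  assumes rate_pos: "rate > 0"
    and rv: "\<And>t. t \<ge> 0 \<Longrightarrow> random_variable (count_space UNIV) (N t)"
    and start: "AE \<omega> in M. N 0 \<omega> = 0"
    and nondecreasing_paths: "AE \<omega> in M. mono_on {0..} (\<lambda>t. N t \<omega>)"
    and right_continuous_paths:
      "AE \<omega> in M. \<forall>t\<ge>0. continuous (at_right t) (\<lambda>s. N s \<omega>)"
    and increments_indep:
      "\<And>(n::nat) \<tau>. \<tau> 0 \<ge> 0 \<Longrightarrow> (\<And>i. i < n \<Longrightarrow> \<tau> i < \<tau> (Suc i)) \<Longrightarrow>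
         indep_vars (\<lambda>_. count_space UNIV) (\<lambda>i \<omega>. N (\<tau> (Suc i)) \<omega> - N (\<tau> i) \<omega>) {..<n}"
    and increments_poisson:
      "\<And>s t. 0 \<le> s \<Longrightarrow> s < t \<Longrightarrow>
         distr M (count_space UNIV) (\<lambda>\<omega>. N t \<omega> - N s \<omega>) =
         measure_pmf (poisson_pmf (rate * (t - s)))"

context prob_space
begin

text \<open>
  The library constant \<^const>\<open>indep_var\<close> forces both random variables to have values of the same
  type; here the value types may differ, as is needed for the independence of a sequence
  and a continuous-time process.
\<close>

definition indep_rvs :: "'b measure \<Rightarrow> ('a \<Rightarrow> 'b) \<Rightarrow> 'c measure \<Rightarrow> ('a \<Rightarrow> 'c) \<Rightarrow> bool" where
  "indep_rvs S X T Y \<longleftrightarrow>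
     random_variable S X \<and> random_variable T Y \<and>
     indep_set (sets (vimage_algebra (space M) X S)) (sets (vimage_algebra (space M) Y T))"

text \<open>
  Independence of two families as wholes, i.e. of the sigma-algebras they generate. The product
  sigma-algebra lives on extensional functions, hence the restriction to the index sets.
\<close>

definition indep_families ::
    "'i set \<Rightarrow> ('i \<Rightarrow> 'a \<Rightarrow> nat) \<Rightarrow> 'j set \<Rightarrow> ('j \<Rightarrow> 'a \<Rightarrow> nat) \<Rightarrow> bool" where
  "indep_families I X J Y \<longleftrightarrow>
     indep_rvs (Pi\<^sub>M I (\<lambda>_. count_space UNIV)) (\<lambda>\<omega>. \<lambda>i\<in>I. X i \<omega>)
               (Pi\<^sub>M J (\<lambda>_. count_space UNIV)) (\<lambda>\<omega>. \<lambda>j\<in>J. Y j \<omega>)"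

text \<open>
  Measurability is included because \<^const>\<open>distr\<close> is not meaningful for non-measurable functions.
\<close>

definition eq_in_distribution :: "'b measure \<Rightarrow> ('a \<Rightarrow> 'b) \<Rightarrow> ('a \<Rightarrow> 'b) \<Rightarrow> bool" where
  "eq_in_distribution S X Y \<longleftrightarrow>
     random_variable S X \<and> random_variable S Y \<and> distr M S X = distr M S Y"

end

end

theory Submission
  imports Defs
begin

text \<open>
  Almost surely \<open>N\<^sub>\<alpha>(n)\<close> is the sum of its \<open>n\<close> unit increments, which are i.i.d. Poisson and hence
  jointly distributed like \<open>X\<^sub>1, \<dots>, X\<^sub>n\<close>. Conditioning on \<open>N\<^sub>\<beta>(t) = n\<close>, an event independent of
  both families, carries the equality of laws over to the random index. The law of a sum of Poisson
  variables is never needed.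
\<close>

context prob_space
begin

lemma indep_vars_reindex:
  fixes f :: "'i \<Rightarrow> 'j"
  assumes inj: "inj_on f I" and indep: "indep_vars M' X (f ` I)"
  shows "indep_vars (M' \<circ> f) (X \<circ> f) I"
proof -
  have "indep_sets (F \<circ> f) I" if F: "indep_sets F (f ` I)" for F :: "'j \<Rightarrow> 'a set set"
  proof (rule indep_setsI)
    show "(F \<circ> f) i \<subseteq> events" if "i \<in> I" for i
      using F that by (auto simp: indep_sets_def)
    fix A J
    assume J: "J \<noteq> {}" "J \<subseteq> I" "finite J" and A: "\<forall>j\<in>J. A j \<in> (F \<circ> f) j"
    have injJ: "inj_on f J"
      using inj J by (auto intro: inj_on_subset)
    define B where "B = A \<circ> inv_into J f"
    have B: "B (f j) = A j" if "j \<in> J" for j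
      using that injJ by (simp add: B_def)
    have "prob (\<Inter>k\<in>f ` J. B k) = (\<Prod>k\<in>f ` J. prob (B k))"
      using J A B by (intro indep_setsD[OF F]) auto
    then show "prob (\<Inter>j\<in>J. A j) = (\<Prod>j\<in>J. prob (A j))"
      using B by (simp add: prod.reindex[OF injJ] cong: INF_cong_simp prod.cong)
  qed
  from this[of "\<lambda>k. {X k -` A \<inter> space M |A. A \<in> sets (M' k)}"] show ?thesis
    using indep by (auto simp: indep_vars_def2 comp_def)
qed

text \<open>Independence makes the joint law the product of the marginals, so equal marginals give
  equal joint laws. The sum is a fixed measurable function of the vector, and its law is the image
  of the joint law.\<close>

lemma eq_in_distribution_sum:
  fixes X Y :: "nat \<Rightarrow> 'a \<Rightarrow> nat"
  assumes X: "indep_vars (\<lambda>_. count_space UNIV) X {..<n}"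
    and Y: "indep_vars (\<lambda>_. count_space UNIV) Y {..<n}"
    and eq: "\<And>i. i < n \<Longrightarrow> distr M (count_space UNIV) (X i) = distr M (count_space UNIV) (Y i)"
  shows "eq_in_distribution (count_space UNIV) (\<lambda>\<omega>. \<Sum>i<n. X i \<omega>) (\<lambda>\<omega>. \<Sum>i<n. Y i \<omega>)"
\<comment> \<open>The characterisation of independence by a product law is stated for nonempty index
  sets; for \<open>n = 0\<close> both sums are the constant 0.\<close>
proof (cases "n = 0")
  case True
  then show ?thesis by (simp add: eq_in_distribution_def)
next
  case False
  let ?P = "Pi\<^sub>M {..<n} (\<lambda>_. count_space UNIV :: nat measure)"
  have joint_measurable: "(\<lambda>\<omega>. \<lambda>i\<in>{..<n}. Z i \<omega>) \<in> M \<rightarrow>\<^sub>M ?P"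
    and joint_law: "distr M ?P (\<lambda>\<omega>. \<lambda>i\<in>{..<n}. Z i \<omega>)
        = Pi\<^sub>M {..<n} (\<lambda>i. distr M (count_space UNIV) (Z i))"
    if "indep_vars (\<lambda>_. count_space UNIV) Z {..<n}" for Z :: "nat \<Rightarrow> 'a \<Rightarrow> nat"
  proof -
    have rv: "i \<in> {..<n} \<Longrightarrow> random_variable (count_space UNIV) (Z i)" for i
      using that by (auto simp: indep_vars_def)
    then show "(\<lambda>\<omega>. \<lambda>i\<in>{..<n}. Z i \<omega>) \<in> M \<rightarrow>\<^sub>M ?P"
      by (intro measurable_restrict) auto
    show "distr M ?P (\<lambda>\<omega>. \<lambda>i\<in>{..<n}. Z i \<omega>)
        = Pi\<^sub>M {..<n} (\<lambda>i. distr M (count_space UNIV) (Z i))"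
      using that False rv by (subst (asm) indep_vars_iff_distr_eq_PiM') auto
  qed
  have sum_measurable: "(\<lambda>f. \<Sum>i<n. f i) \<in> ?P \<rightarrow>\<^sub>M count_space UNIV"
    by measurable
  have law: "distr M (count_space UNIV) (\<lambda>\<omega>. \<Sum>i<n. Z i \<omega>)
      = distr (Pi\<^sub>M {..<n} (\<lambda>i. distr M (count_space UNIV) (Z i))) (count_space UNIV) (\<lambda>f. \<Sum>i<n. f i)"
    and rv: "random_variable (count_space UNIV) (\<lambda>\<omega>. \<Sum>i<n. Z i \<omega>)"
    if "indep_vars (\<lambda>_. count_space UNIV) Z {..<n}" for Z :: "nat \<Rightarrow> 'a \<Rightarrow> nat"
  proof -
    have comp: "(\<lambda>f. \<Sum>i<n. f i) \<circ> (\<lambda>\<omega>. \<lambda>i\<in>{..<n}. Z i \<omega>) = (\<lambda>\<omega>. \<Sum>i<n. Z i \<omega>)"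
      by (auto simp: fun_eq_iff)
    show "distr M (count_space UNIV) (\<lambda>\<omega>. \<Sum>i<n. Z i \<omega>)
      = distr (Pi\<^sub>M {..<n} (\<lambda>i. distr M (count_space UNIV) (Z i))) (count_space UNIV) (\<lambda>f. \<Sum>i<n. f i)"
      using distr_distr[OF sum_measurable joint_measurable[OF that]]
      by (simp add: comp joint_law[OF that])
    show "random_variable (count_space UNIV) (\<lambda>\<omega>. \<Sum>i<n. Z i \<omega>)"
      using measurable_comp[OF joint_measurable[OF that] sum_measurable] by (simp only: comp)
  qed
  have "Pi\<^sub>M {..<n} (\<lambda>i. distr M (count_space UNIV) (X i))
      = Pi\<^sub>M {..<n} (\<lambda>i. distr M (count_space UNIV) (Y i))"
    using eq by (intro PiM_cong) auto
  then show ?thesis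
    using law[OF X] law[OF Y] rv[OF X] rv[OF Y] by (simp add: eq_in_distribution_def)
qed

text \<open>Both events are preimages of measurable sets, hence lie in the generated sigma-algebras.
  This turns independence of whole families into a product rule for events read off from
  them.\<close>

lemma indep_families_prob_Int:
  assumes "indep_families I X J Y"
    and A: "A \<in> sets (Pi\<^sub>M I (\<lambda>_. count_space UNIV))"
    and B: "B \<in> sets (Pi\<^sub>M J (\<lambda>_. count_space UNIV))"
  shows "prob ({\<omega> \<in> space M. (\<lambda>i\<in>I. X i \<omega>) \<in> A} \<inter> {\<omega> \<in> space M. (\<lambda>j\<in>J. Y j \<omega>) \<in> B})
    = prob {\<omega> \<in> space M. (\<lambda>i\<in>I. X i \<omega>) \<in> A} * prob {\<omega> \<in> space M. (\<lambda>j\<in>J. Y j \<omega>) \<in> B}"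
proof -
  have eq: "{\<omega> \<in> space M. (\<lambda>i\<in>I. X i \<omega>) \<in> A} = (\<lambda>\<omega>. \<lambda>i\<in>I. X i \<omega>) -` A \<inter> space M"
    "{\<omega> \<in> space M. (\<lambda>j\<in>J. Y j \<omega>) \<in> B} = (\<lambda>\<omega>. \<lambda>j\<in>J. Y j \<omega>) -` B \<inter> space M"
    by auto
  show ?thesis
    unfolding eq
    by (rule indep_setD[OF assms(1)[unfolded indep_families_def indep_rvs_def, THEN conjunct2, THEN conjunct2]])
      (auto intro: in_vimage_algebra A B)
qed

text \<open>Law of total probability over the value of \<open>K\<close>: on the event
  \<open>K = n\<close> the variable with random index is \<open>W n\<close>. Each \<open>W n\<close>
  has to be independent of \<open>K\<close> separately; the dependence between different
  \<open>W n\<close> is arbitrary.\<close>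

lemma emeasure_distr_random_index:
  fixes W :: "nat \<Rightarrow> 'a \<Rightarrow> nat" and K :: "'a \<Rightarrow> nat"
  assumes W[measurable]: "\<And>n. random_variable (count_space UNIV) (W n)"
    and K[measurable]: "random_variable (count_space UNIV) K"
    and indep: "\<And>n k. prob ({\<omega> \<in> space M. W n \<omega> = k} \<inter> {\<omega> \<in> space M. K \<omega> = n})
      = prob {\<omega> \<in> space M. W n \<omega> = k} * prob {\<omega> \<in> space M. K \<omega> = n}"
  shows "emeasure (distr M (count_space UNIV) (\<lambda>\<omega>. W (K \<omega>) \<omega>)) {k}
    = (\<Sum>n. emeasure (distr M (count_space UNIV) (W n)) {k} * prob {\<omega> \<in> space M. K \<omega> = n})"
proof -
  let ?E = "\<lambda>n. {\<omega> \<in> space M. W n \<omega> = k} \<inter> {\<omega> \<in> space M. K \<omega> = n}"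
  have "emeasure (distr M (count_space UNIV) (\<lambda>\<omega>. W (K \<omega>) \<omega>)) {k} = emeasure M (\<Union>n. ?E n)"
    by (subst emeasure_distr) (auto intro!: arg_cong[where f = "emeasure M"])
  \<comment> \<open>The pieces are disjoint because \<open>K\<close> takes a single value at each
    outcome.\<close>
  also have "\<dots> = (\<Sum>n. emeasure M (?E n))"
    by (intro suminf_emeasure[symmetric]) (auto simp: disjoint_family_on_def)
  also have "\<dots> = (\<Sum>n. emeasure (distr M (count_space UNIV) (W n)) {k} * prob {\<omega> \<in> space M. K \<omega> = n})"
  proof (intro suminf_cong)
    fix n
    have "emeasure (distr M (count_space UNIV) (W n)) {k} = prob {\<omega> \<in> space M. W n \<omega> = k}"
      by (subst emeasure_distr)
        (auto simp: emeasure_eq_measure intro!: arg_cong[where f = prob])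
    then show "emeasure M (?E n)
        = emeasure (distr M (count_space UNIV) (W n)) {k} * prob {\<omega> \<in> space M. K \<omega> = n}"
      by (simp add: emeasure_eq_measure indep ennreal_mult)
  qed
  finally show ?thesis .
qed

text \<open>The total probability formula involves \<open>W\<close> only through the laws of the
  single \<open>W n\<close>, so replacing them by the \<open>W' n\<close> leaves it unchanged. On a
  countable type, the masses of singletons determine the law.\<close>

lemma eq_in_distribution_random_index:
  fixes W W' :: "nat \<Rightarrow> 'a \<Rightarrow> nat" and K :: "'a \<Rightarrow> nat"
  assumes eq: "\<And>n. eq_in_distribution (count_space UNIV) (W n) (W' n)"
    and K: "random_variable (count_space UNIV) K"
    and indep: "\<And>n k. prob ({\<omega> \<in> space M. W n \<omega> = k} \<inter> {\<omega> \<in> space M. K \<omega> = n})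
      = prob {\<omega> \<in> space M. W n \<omega> = k} * prob {\<omega> \<in> space M. K \<omega> = n}"
    and indep': "\<And>n k. prob ({\<omega> \<in> space M. W' n \<omega> = k} \<inter> {\<omega> \<in> space M. K \<omega> = n})
      = prob {\<omega> \<in> space M. W' n \<omega> = k} * prob {\<omega> \<in> space M. K \<omega> = n}"
  shows "eq_in_distribution (count_space UNIV) (\<lambda>\<omega>. W (K \<omega>) \<omega>) (\<lambda>\<omega>. W' (K \<omega>) \<omega>)"
proof -
  have W: "random_variable (count_space UNIV) (W n)"
    and W': "random_variable (count_space UNIV) (W' n)"
    and distr: "distr M (count_space UNIV) (W n) = distr M (count_space UNIV) (W' n)" for n
    using eq[of n] by (auto simp: eq_in_distribution_def)
  have "distr M (count_space UNIV) (\<lambda>\<omega>. W (K \<omega>) \<omega>)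
      = distr M (count_space UNIV) (\<lambda>\<omega>. W' (K \<omega>) \<omega>)"
  proof (rule measure_eqI_countable)
    fix k :: nat
    show "emeasure (distr M (count_space UNIV) (\<lambda>\<omega>. W (K \<omega>) \<omega>)) {k}
        = emeasure (distr M (count_space UNIV) (\<lambda>\<omega>. W' (K \<omega>) \<omega>)) {k}"
      using emeasure_distr_random_index[OF W K indep] emeasure_distr_random_index[OF W' K indep']
      by (simp add: distr)
  qed auto
  \<comment> \<open>Measurability survives the random index because \<open>K\<close> has only
    countably many values.\<close>
  moreover have "random_variable (count_space UNIV) (\<lambda>\<omega>. W (K \<omega>) \<omega>)"
    "random_variable (count_space UNIV) (\<lambda>\<omega>. W' (K \<omega>) \<omega>)"
    by (rule measurable_compose_countable[OF W K], rule measurable_compose_countable[OF W' K])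
  ultimately show ?thesis
    by (simp add: eq_in_distribution_def)
qed

end

context poisson_process
begin

text \<open>The sum telescopes down to \<open>N 0\<close>, almost surely 0. Monotone paths are what
  makes the truncated subtraction a true difference.\<close>

lemma AE_eq_sum_increments: "AE \<omega> in M. N (real n) \<omega> = (\<Sum>i<n. N (real (Suc i)) \<omega> - N (real i) \<omega>)"
  using start nondecreasing_paths
proof eventually_elim
  case (elim \<omega>)
  show ?case
  proof (induction n)
    case (Suc n)
    have "N (real n) \<omega> \<le> N (real (Suc n)) \<omega>"
      using elim(2) by (auto simp: mono_on_def)
    with Suc show ?case by simp
  qed (use elim in simp)
qed

lemma eq_in_distribution_sum_iid:
  fixes X :: "nat \<Rightarrow> 'a \<Rightarrow> nat"
  assumes indep: "indep_vars (\<lambda>_. count_space UNIV) X {1..}"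
    and law: "\<And>j. j \<ge> 1 \<Longrightarrow> distr M (count_space UNIV) (X j) = measure_pmf (poisson_pmf rate)"
  shows "eq_in_distribution (count_space UNIV) (N (real n)) (\<lambda>\<omega>. \<Sum>j=1..n. X j \<omega>)"
proof -
  let ?D = "\<lambda>i \<omega>. N (real (Suc i)) \<omega> - N (real i) \<omega>"
  \<comment> \<open>The partition points are the integers 0, ..., n, that is, \<tau> is
    \<open>real\<close>.\<close>
  have "indep_vars (\<lambda>_. count_space UNIV) ?D {..<n}"
    using increments_indep[of real n] by simp
  \<comment> \<open>The shift by \<open>Suc\<close> aligns the variables, numbered from 1, with the
    increments, numbered from 0.\<close>
  moreover have "indep_vars (\<lambda>_. count_space UNIV) (\<lambda>i. X (Suc i)) {..<n}"
    using indep_vars_reindex[of Suc "{..<n}" "\<lambda>_. count_space UNIV" X]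
      indep_vars_subset[OF indep, of "Suc ` {..<n}"]
    by (auto simp: comp_def)
  \<comment> \<open>An increment over a unit interval has parameter \<open>rate * 1\<close>, the
    parameter of each \<open>X j\<close>.\<close>
  moreover have "distr M (count_space UNIV) (?D i) = distr M (count_space UNIV) (X (Suc i))" for i
    using increments_poisson[of "real i" "real (Suc i)"] law[of "Suc i"] by simp
  ultimately have sums: "eq_in_distribution (count_space UNIV)
      (\<lambda>\<omega>. \<Sum>i<n. ?D i \<omega>) (\<lambda>\<omega>. \<Sum>i<n. X (Suc i) \<omega>)"
    by (rule eq_in_distribution_sum)
  \<comment> \<open>The telescoping identity holds only almost surely, which is enough for equality
    of laws.\<close>
  have "distr M (count_space UNIV) (N (real n)) = distr M (count_space UNIV) (\<lambda>\<omega>. \<Sum>i<n. ?D i \<omega>)"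
    using AE_eq_sum_increments[of n] rv[of "real n"] sums
    by (intro distr_cong_AE) (auto simp: eq_in_distribution_def)
  moreover have "(\<Sum>i<n. X (Suc i) \<omega>) = (\<Sum>j=1..n. X j \<omega>)" for \<omega>
    by (rule sum.reindex_bij_witness[of _ "\<lambda>j. j - 1" Suc]) auto
  ultimately show ?thesis
    using sums rv[of "real n"] by (simp add: eq_in_distribution_def)
qed

end

theorem theorem2p2:
  fixes M :: "'a measure"
    and rate\<^sub>\<alpha> rate\<^sub>\<beta> :: real
    and N\<^sub>\<alpha> N\<^sub>\<beta> :: "real \<Rightarrow> 'a \<Rightarrow> nat"
    and X :: "nat \<Rightarrow> 'a \<Rightarrow> nat"
    and t :: real
  assumes "prob_space M"
    and "rate\<^sub>\<alpha> > 0" and "rate\<^sub>\<beta> > 0"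
    and "poisson_process M rate\<^sub>\<alpha> N\<^sub>\<alpha>"
    and "poisson_process M rate\<^sub>\<beta> N\<^sub>\<beta>"
    and "prob_space.indep_families M {0..} N\<^sub>\<alpha> {0..} N\<^sub>\<beta>"
    and "prob_space.indep_vars M (\<lambda>_. count_space UNIV) X {1..}"
    and "\<And>j. j \<ge> 1 \<Longrightarrow> distr M (count_space UNIV) (X j) = measure_pmf (poisson_pmf rate\<^sub>\<alpha>)"
    and "prob_space.indep_families M {1..} X {0..} N\<^sub>\<beta>"
    and "t > 0"
  shows "prob_space.eq_in_distribution M (count_space UNIV)
           (\<lambda>\<omega>. N\<^sub>\<alpha> (real (N\<^sub>\<beta> t \<omega>)) \<omega>)
           (\<lambda>\<omega>. \<Sum>j = 1..N\<^sub>\<beta> t \<omega>. X j \<omega>)"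
proof -
  interpret \<alpha>: poisson_process M rate\<^sub>\<alpha> N\<^sub>\<alpha> by fact
  interpret \<beta>: poisson_process M rate\<^sub>\<beta> N\<^sub>\<beta> by fact
  let ?P = "Pi\<^sub>M {0::real..} (\<lambda>_. count_space UNIV :: nat measure)"
  let ?Q = "Pi\<^sub>M {1::nat..} (\<lambda>_. count_space UNIV :: nat measure)"
  \<comment> \<open>These cylinder sets depend on finitely many coordinates, all inside the index
    sets: \<open>t\<close> and \<open>real n\<close> are nonnegative, and the sum starts at
    1.\<close>
  have B: "{f \<in> space ?P. f t = n} \<in> sets ?P" for n
    using \<open>t > 0\<close> by (measurable, simp)
  have A: "{f \<in> space ?P. f (real n) = k} \<in> sets ?P" for n k
    by measurable
  have A': "{f \<in> space ?Q. (\<Sum>j=1..n. f j) = k} \<in> sets ?Q" for n k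
    by measurable
  show ?thesis
  proof (rule \<alpha>.eq_in_distribution_random_index[where W = "\<lambda>n. N\<^sub>\<alpha> (real n)"])
    show "\<alpha>.eq_in_distribution (count_space UNIV) (N\<^sub>\<alpha> (real n)) (\<lambda>\<omega>. \<Sum>j=1..n. X j \<omega>)" for n
      using assms(7,8) by (rule \<alpha>.eq_in_distribution_sum_iid)
    show "\<alpha>.random_variable (count_space UNIV) (N\<^sub>\<beta> t)"
      using \<beta>.rv \<open>t > 0\<close> by simp
    \<comment> \<open>In both product rules, restricting the families to their index sets leaves the
      coordinates in question unchanged, so the cylinder sets pull back to exactly the events named
      here.\<close>
    fix n k
    show "\<alpha>.prob ({\<omega> \<in> space M. N\<^sub>\<alpha> (real n) \<omega> = k} \<inter> {\<omega> \<in> space M. N\<^sub>\<beta> t \<omega> = n})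
      = \<alpha>.prob {\<omega> \<in> space M. N\<^sub>\<alpha> (real n) \<omega> = k} * \<alpha>.prob {\<omega> \<in> space M. N\<^sub>\<beta> t \<omega> = n}"
      using \<alpha>.indep_families_prob_Int[OF assms(6) A[of n k] B[of n]] \<open>t > 0\<close>
      by (simp add: space_PiM)
    show "\<alpha>.prob ({\<omega> \<in> space M. (\<Sum>j=1..n. X j \<omega>) = k} \<inter> {\<omega> \<in> space M. N\<^sub>\<beta> t \<omega> = n})
      = \<alpha>.prob {\<omega> \<in> space M. (\<Sum>j=1..n. X j \<omega>) = k} * \<alpha>.prob {\<omega> \<in> space M. N\<^sub>\<beta> t \<omega> = n}"
      using \<alpha>.indep_families_prob_Int[OF assms(9) A'[of n k] B[of n]] \<open>t > 0\<close>
      by (simp add: space_PiM)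
  qed
qed

end
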